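(* Let $A$ be a complex square matrix whose spectral norm equals its spectral radius. If $\lambda$ is any eigenvalue of $A$ of maximum modulus, then every Jordan block of $A$ for $\lambda$ is of size $1\times 1$.
   Context: The spectral norm of $A$ is the operator norm with respect to the Euclidean norm, and the spectral radius is the maximum modulus of the eigenvalues of $A$. "Jordan block" refers to the blocks in the Jordan normal form of $A$. *)

theory Defs
  imports
    "HOL-Analysis.L2_Norm"
    "Jordan_Normal_Form.Spectral_Radius"
begin

definition vec_norm2 :: "complex vec \<Rightarrow> real" where
  "vec_norm2 v = L2_set (\<lambda>i. cmod (v $ i)) {..<dim_vec v}"

(* The supremum over the closed unit ball, rather than the unit sphere, is never over an
   empty set: a matrix without columns gets norm 0. *)
definition spectral_norm :: "complex mat \<Rightarrow> real" where
  "spectral_norm A =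
     (SUP v \<in> {v \<in> carrier_vec (dim_col A). vec_norm2 v \<le> 1}. vec_norm2 (A *\<^sub>v v))"

end

theory Submission
  imports Defs "Jordan_Normal_Form.Jordan_Normal_Form_Uniqueness"
begin

text \<open>
  Write \<open>r = \<bar>\<lambda>\<bar>\<close>, so that the hypotheses give \<open>\<parallel>A w\<parallel> \<le> r \<parallel>w\<parallel>\<close> for all \<open>w\<close>. A Jordan block of
  \<open>\<lambda>\<close> of size at least \<open>2\<close> would provide a chain \<open>A v = \<lambda> v\<close>, \<open>A u = \<lambda> u + v\<close> with \<open>v \<noteq> 0\<close>. The
  relation \<open>A u = \<lambda> u + v\<close> survives subtracting a multiple of the eigenvector \<open>v\<close> from \<open>u\<close>, so \<open>u\<close>
  may be taken orthogonal to \<open>v\<close>. Then the two summands of \<open>A u\<close> are orthogonal, and Pythagoras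
  gives \<open>\<parallel>A u\<parallel>\<^sup>2 = r\<^sup>2 \<parallel>u\<parallel>\<^sup>2 + \<parallel>v\<parallel>\<^sup>2 > r\<^sup>2 \<parallel>u\<parallel>\<^sup>2\<close>, a contradiction. This is
  \<open>no_jordan_chain_if_norm_bounded\<close>.

  The absence of chains means that \<open>A - \<lambda> I\<close> and its square have the same kernel. The
  dimension of the kernel of \<open>(A - \<lambda> I)\<^sup>j\<close> is the sum of \<open>min j k\<close> over the sizes \<open>k\<close> of the blocks
  of \<open>\<lambda>\<close>, so the equality of the two kernels leaves only blocks of size \<open>1\<close>; this is
  \<open>jordan_block_size_one_if_kernel_stable\<close>.
\<close>

section \<open>The Euclidean norm and the Hermitian product\<close>

lemma cscalar_prod_self_eq_norm2: "v \<bullet>c v = complex_of_real ((vec_norm2 v)\<^sup>2)"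
proof -
  have "(vec_norm2 v)\<^sup>2 = (\<Sum>i<dim_vec v. (cmod (v $ i))\<^sup>2)"
    unfolding vec_norm2_def L2_set_def by (simp add: sum_nonneg)
  moreover have "v \<bullet>c v = (\<Sum>i<dim_vec v. complex_of_real ((cmod (v $ i))\<^sup>2))"
    unfolding scalar_prod_def
    by (simp add: lessThan_atLeast0 complex_norm_square del: of_real_power)
  ultimately show ?thesis by simp
qed

lemma vec_norm2_nonneg: "0 \<le> vec_norm2 v"
  unfolding vec_norm2_def by simp

lemma vec_norm2_eq_0_iff:
  assumes "v \<in> carrier_vec n"
  shows "vec_norm2 v = 0 \<longleftrightarrow> v = 0\<^sub>v n"
  using conjugate_square_eq_0_vec[OF assms] by (simp add: cscalar_prod_self_eq_norm2)

lemma vec_norm2_smult: "vec_norm2 (c \<cdot>\<^sub>v v) = cmod c * vec_norm2 v"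
proof -
  have "vec_norm2 (c \<cdot>\<^sub>v v) = L2_set (\<lambda>i. cmod c * cmod (v $ i)) {..<dim_vec v}"
    unfolding vec_norm2_def by (auto intro!: L2_set_cong simp: norm_mult)
  then show ?thesis
    unfolding vec_norm2_def by (simp add: L2_set_right_distrib)
qed

lemma vec_norm2_add_orthogonal:
  assumes x: "x \<in> carrier_vec n" and y: "y \<in> carrier_vec n" and orth: "x \<bullet>c y = 0"
  shows "(vec_norm2 (x + y))\<^sup>2 = (vec_norm2 x)\<^sup>2 + (vec_norm2 y)\<^sup>2"
proof -
  have orth': "y \<bullet>c x = 0"
  proof -
    have "y \<bullet>c x = conjugate x \<bullet> y"
      using y x by (rule conjugate_vec_sprod_comm)
    also have "\<dots> = conjugate (x \<bullet>c y)"
      using conjugate_sprod_vec[OF x carrier_vec_conjugate[OF y]] by simp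
    finally show ?thesis using orth by simp
  qed
  have "(x + y) \<bullet>c (x + y) = x \<bullet>c x + y \<bullet>c y"
    using x y orth orth'
    by (simp add: conjugate_add_vec[OF x y] add_scalar_prod_distrib[of _ n]
        scalar_prod_add_distrib[of _ n])
  then have "complex_of_real ((vec_norm2 (x + y))\<^sup>2)
      = complex_of_real ((vec_norm2 x)\<^sup>2 + (vec_norm2 y)\<^sup>2)"
    by (simp only: cscalar_prod_self_eq_norm2 of_real_add)
  then show ?thesis by (simp only: of_real_eq_iff)
qed

section \<open>The spectral norm bounds the matrix\<close>

text \<open>
  A supremum of reals is meaningful only over a bounded set. On the unit ball every entry of \<open>v\<close>
  has modulus at most \<open>1\<close>, so the entries of \<open>A v\<close> are bounded by the absolute row sums of \<open>A\<close>.
\<close>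

lemma bdd_above_norm_on_unit_ball:
  "bdd_above ((\<lambda>v. vec_norm2 (A *\<^sub>v v)) ` {v \<in> carrier_vec (dim_col A). vec_norm2 v \<le> 1})"
proof (rule bdd_aboveI2)
  fix v assume "v \<in> {v \<in> carrier_vec (dim_col A). vec_norm2 v \<le> 1}"
  then have dim: "dim_vec v = dim_col A" and le: "vec_norm2 v \<le> 1" by auto
  have entry: "cmod (v $ j) \<le> 1" if "j < dim_col A" for j
  proof -
    have "cmod (v $ j) \<le> vec_norm2 v"
      unfolding vec_norm2_def using that dim by (intro member_le_L2_set) auto
    then show ?thesis using le by simp
  qed
  have "cmod ((A *\<^sub>v v) $ i) \<le> (\<Sum>j<dim_col A. cmod (A $$ (i, j)))" if i: "i < dim_row A" for i
  proof -
    have "(A *\<^sub>v v) $ i = (\<Sum>j<dim_col A. A $$ (i, j) * v $ j)"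
      using i dim by (simp add: scalar_prod_def lessThan_atLeast0)
    also have "cmod \<dots> \<le> (\<Sum>j<dim_col A. cmod (A $$ (i, j) * v $ j))"
      by (rule norm_sum)
    also have "\<dots> \<le> (\<Sum>j<dim_col A. cmod (A $$ (i, j)))"
      using entry by (intro sum_mono) (simp add: norm_mult mult_left_le)
    finally show ?thesis .
  qed
  then show "vec_norm2 (A *\<^sub>v v)
      \<le> L2_set (\<lambda>i. \<Sum>j<dim_col A. cmod (A $$ (i, j))) {..<dim_row A}"
    unfolding vec_norm2_def by (auto intro!: L2_set_mono)
qed

lemma vec_norm2_mult_le_spectral_norm:
  assumes v: "v \<in> carrier_vec (dim_col A)"
  shows "vec_norm2 (A *\<^sub>v v) \<le> spectral_norm A * vec_norm2 v"
proof (cases "vec_norm2 v = 0")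
  case True
  then have "v = 0\<^sub>v (dim_col A)" using vec_norm2_eq_0_iff[OF v] by simp
  then have "A *\<^sub>v v = 0\<^sub>v (dim_row A)" by auto
  then have "vec_norm2 (A *\<^sub>v v) = 0"
    using vec_norm2_eq_0_iff[of "A *\<^sub>v v" "dim_row A"] by simp
  then show ?thesis using True by simp
next
  case False
  then have pos: "vec_norm2 v > 0" using vec_norm2_nonneg[of v] by simp
  define c where "c = complex_of_real (1 / vec_norm2 v)"
  have "vec_norm2 (c \<cdot>\<^sub>v v) = 1"
    using pos by (simp add: vec_norm2_smult c_def norm_divide)
  then have "vec_norm2 (A *\<^sub>v (c \<cdot>\<^sub>v v)) \<le> spectral_norm A"
    unfolding spectral_norm_def
    using v by (intro cSUP_upper bdd_above_norm_on_unit_ball) simp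
  moreover have "A *\<^sub>v (c \<cdot>\<^sub>v v) = c \<cdot>\<^sub>v (A *\<^sub>v v)"
    using v by (intro mult_mat_vec) auto
  ultimately have "vec_norm2 (A *\<^sub>v v) / vec_norm2 v \<le> spectral_norm A"
    using pos by (simp add: vec_norm2_smult c_def norm_divide)
  then show ?thesis using pos by (simp add: field_simps)
qed

section \<open>Jordan chains and Jordan blocks\<close>

lemma char_matrix_mult_vec:
  assumes A: "A \<in> carrier_mat n n" and v: "v \<in> carrier_vec n"
  shows "A *\<^sub>v v = e \<cdot>\<^sub>v v + char_matrix A e *\<^sub>v v"
proof -
  have "char_matrix A e *\<^sub>v v = A *\<^sub>v v + (- e) \<cdot>\<^sub>v v"
    unfolding char_matrix_def using A v
    by (intro eq_vecI) (auto simp: add_scalar_prod_distrib[of _ n])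
  then show ?thesis
    using A v by (intro eq_vecI) auto
qed

text \<open>
  Let \<open>w\<close> be the component of \<open>u\<close> orthogonal to \<open>v\<close>. Then \<open>A w = e w + v\<close> is an orthogonal sum
  whose first summand already has the largest norm that the bound allows.
\<close>

lemma no_jordan_chain_if_norm_bounded:
  assumes A: "A \<in> carrier_mat n n"
    and bound: "\<And>w. w \<in> carrier_vec n \<Longrightarrow> vec_norm2 (A *\<^sub>v w) \<le> cmod e * vec_norm2 w"
    and u: "u \<in> carrier_vec n" and v: "v \<in> carrier_vec n"
    and Av: "A *\<^sub>v v = e \<cdot>\<^sub>v v" and Au: "A *\<^sub>v u = e \<cdot>\<^sub>v u + v"
  shows "v = 0\<^sub>v n"
proof (rule ccontr)
  assume "v \<noteq> 0\<^sub>v n"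
  then have vv: "v \<bullet>c v \<noteq> 0" using v by simp
  \<comment> \<open>The coefficient of the orthogonal projection of \<open>u\<close> onto the line spanned by \<open>v\<close>.\<close>
  define t where "t = (u \<bullet>c v) / (v \<bullet>c v)"
  define w where "w = u + (- t) \<cdot>\<^sub>v v"
  have w: "w \<in> carrier_vec n" unfolding w_def using u v by simp
  have "w \<bullet>c v = u \<bullet>c v + (- t) * (v \<bullet>c v)"
    unfolding w_def using u v by (simp add: add_scalar_prod_distrib[of _ n])
  then have "w \<bullet>c v = 0" unfolding t_def using vv by simp
  then have orth: "(e \<cdot>\<^sub>v w) \<bullet>c v = 0"
    using w v by simp
  have "A *\<^sub>v w = (e \<cdot>\<^sub>v u + v) + (- t) \<cdot>\<^sub>v (e \<cdot>\<^sub>v v)"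
    unfolding w_def using A u v
    by (simp add: mult_add_distrib_mat_vec[of _ n n] mult_mat_vec[of _ n n] Au Av)
  also have "\<dots> = e \<cdot>\<^sub>v w + v"
    unfolding w_def using u v by (intro eq_vecI) (auto simp: algebra_simps)
  finally have "(vec_norm2 (A *\<^sub>v w))\<^sup>2 = (cmod e * vec_norm2 w)\<^sup>2 + (vec_norm2 v)\<^sup>2"
    using vec_norm2_add_orthogonal[of "e \<cdot>\<^sub>v w" n v] w v orth by (simp add: vec_norm2_smult)
  moreover have "(vec_norm2 (A *\<^sub>v w))\<^sup>2 \<le> (cmod e * vec_norm2 w)\<^sup>2"
    using bound[OF w] vec_norm2_nonneg by (rule power_mono)
  ultimately have "vec_norm2 v = 0" by simp
  then show False using \<open>v \<noteq> 0\<^sub>v n\<close> vec_norm2_eq_0_iff[OF v] by simp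
qed

lemma mat_kernel_char_matrix_square_if_norm_bounded:
  assumes A: "A \<in> carrier_mat n n"
    and bound: "\<And>w. w \<in> carrier_vec n \<Longrightarrow> vec_norm2 (A *\<^sub>v w) \<le> cmod e * vec_norm2 w"
  shows "mat_kernel (char_matrix A e ^\<^sub>m 2) = mat_kernel (char_matrix A e)"
proof -
  let ?M = "char_matrix A e"
  have M: "?M \<in> carrier_mat n n" using A by simp
  have sq: "?M ^\<^sub>m 2 = ?M * ?M"
    using M by (simp add: numeral_2_eq_2)
  have "u \<in> mat_kernel ?M" if "u \<in> mat_kernel (?M * ?M)" for u
  proof -
    have u: "u \<in> carrier_vec n" and "?M * ?M *\<^sub>v u = 0\<^sub>v n"
      using mat_kernelD[OF _ that, of n n] M by auto
    then have MMu: "?M *\<^sub>v (?M *\<^sub>v u) = 0\<^sub>v n"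
      using M assoc_mult_mat_vec[OF M M u] by simp
    have v: "?M *\<^sub>v u \<in> carrier_vec n" using M u by simp
    have "A *\<^sub>v (?M *\<^sub>v u) = e \<cdot>\<^sub>v (?M *\<^sub>v u)"
      using char_matrix_mult_vec[OF A v, of e] MMu v by simp
    then have "?M *\<^sub>v u = 0\<^sub>v n"
      using no_jordan_chain_if_norm_bounded[OF A bound u v] char_matrix_mult_vec[OF A u] by simp
    then show ?thesis using mat_kernelI[OF M u] by simp
  qed
  then show ?thesis
    unfolding sq using mat_kernel_mult_subset[OF M M] by blast
qed

text \<open>
  The dimensions of the first two generalized eigenspaces differ by the number of blocks of
  size at least \<open>2\<close>.
\<close>

lemma jordan_block_size_one_if_kernel_stable:
  assumes A: "A \<in> carrier_mat n n"
    and ker: "mat_kernel (char_matrix A e ^\<^sub>m 2) = mat_kernel (char_matrix A e)"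
    and jnf: "jordan_nf A n_as" and mem: "(k, e) \<in> set n_as"
  shows "k = 1"
proof (rule ccontr)
  assume "k \<noteq> 1"
  moreover have "k \<noteq> 0" using jnf mem unfolding jordan_nf_def by force
  ultimately have k: "k \<ge> 2" by simp
  let ?M = "char_matrix A e"
  let ?ks = "map fst [(m, a)\<leftarrow>n_as. a = e]"
  have M: "?M \<in> carrier_mat n n" using A by simp
  have "dim_gen_eigenspace A e 2 = dim_gen_eigenspace A e 1"
    unfolding dim_gen_eigenspace_def kernel_dim_def
    using M ker by simp
  then have eq: "(\<Sum>m\<leftarrow>?ks. min 2 m) = (\<Sum>m\<leftarrow>?ks. min 1 m)"
    unfolding dim_gen_eigenspace[OF jnf] .
  have mem': "k \<in> set ?ks" using mem by force
  have less: "(\<Sum>m\<leftarrow>ks. min 1 m) < (\<Sum>m\<leftarrow>ks. min 2 m)" if "k \<in> set ks" for ks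
  proof -
    from split_list[OF that] obtain xs ys where ks: "ks = xs @ k # ys" by blast
    have le: "(\<Sum>m\<leftarrow>zs. min 1 m) \<le> (\<Sum>m\<leftarrow>zs. min 2 m)" for zs :: "nat list"
      by (rule sum_list_mono) simp
    show ?thesis unfolding ks using le[of xs] le[of ys] k by simp
  qed
  show False using less[OF mem'] eq by linarith
qed

lemma spectral_radius_eq_cmod_dominant_eigenvalue:
  assumes A: "A \<in> carrier_mat n n" and ev: "eigenvalue A e"
    and max: "\<And>\<mu>. eigenvalue A \<mu> \<Longrightarrow> cmod \<mu> \<le> cmod e"
  shows "spectral_radius A = cmod e"
  unfolding spectral_radius_def
  using card_finite_spectrum(1)[OF A] ev max by (intro Max_eqI) (auto simp: spectrum_def)

theorem theorem1p6:
  fixes A :: "complex mat" and n :: nat and lam :: complex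
  assumes "A \<in> carrier_mat n n"
    and "spectral_norm A = spectral_radius A"
    and "eigenvalue A lam"
    and "\<forall>\<mu>. eigenvalue A \<mu> \<longrightarrow> cmod \<mu> \<le> cmod lam"
  shows "\<forall>n_as k. jordan_nf A n_as \<longrightarrow> (k, lam) \<in> set n_as \<longrightarrow> k = 1"
proof -
  have "spectral_norm A = cmod lam"
    using spectral_radius_eq_cmod_dominant_eigenvalue[of A n lam] assms by simp
  then have "vec_norm2 (A *\<^sub>v w) \<le> cmod lam * vec_norm2 w" if "w \<in> carrier_vec n" for w
    using vec_norm2_mult_le_spectral_norm[of w A] that assms(1) by simp
  then show ?thesis
    using mat_kernel_char_matrix_square_if_norm_bounded[OF assms(1)]
      jordan_block_size_one_if_kernel_stable[OF assms(1)] by blast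
qed

end
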